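(* For every integer $k\geq 2$ there exists a finite family $\mathcal{C}$ of $x$-monotone curves in the plane, all of which have nonempty intersection with a fixed vertical line $l$, such that the disjointness graph $G$ of $\mathcal{C}$ satisfies $\omega(G)=k$ and $\chi(G)=\frac{k+1}{2}\binom{k+2}{3}$.
   Context: A curve is the image of a continuous map $\phi:[0,1]\to\mathbb{R}^2$. A curve is $x$-monotone if every vertical line meets it in at most one point. The disjointness graph of a family of curves has the curves as vertices, two vertices being adjacent if and only if the corresponding curves are disjoint. $\omega$ and $\chi$ denote clique number and chromatic number. *)

theory Defs
  imports "HOL-Analysis.Analysis" "HOL-Library.Ramsey"
begin

definition curve :: "(real \<times> real) set \<Rightarrow> bool" where
  "curve C \<longleftrightarrow> (\<exists>\<phi>. path \<phi> \<and> C = path_image \<phi>)"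

definition vertical_line :: "(real \<times> real) set \<Rightarrow> bool" where
  "vertical_line l \<longleftrightarrow> (\<exists>c. l = {p. fst p = c})"

definition x_monotone :: "(real \<times> real) set \<Rightarrow> bool" where
  "x_monotone C \<longleftrightarrow>
     (\<forall>l p q. vertical_line l \<longrightarrow> p \<in> C \<inter> l \<longrightarrow> q \<in> C \<inter> l \<longrightarrow> p = q)"

text \<open>
  A simple graph is a vertex set together with a set of two-element edge sets,
  the convention of \<^const>\<open>Ramsey.clique\<close>.
\<close>

definition disjointness_edges :: "'a set set \<Rightarrow> 'a set set set" where
  "disjointness_edges \<C> = {{A, B} | A B. A \<in> \<C> \<and> B \<in> \<C> \<and> A \<noteq> B \<and> A \<inter> B = {}}"

text \<open>
  The next two numbers are meaningful for finite vertex sets only: otherwise the sets over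
  which \<^const>\<open>Max\<close> and \<^const>\<open>Least\<close> range may be infinite or empty.
\<close>

definition clique_number :: "'a set \<Rightarrow> 'a set set \<Rightarrow> nat" where
  "clique_number V E = Max {card K | K. K \<subseteq> V \<and> clique K E}"

definition proper_coloring :: "'a set \<Rightarrow> 'a set set \<Rightarrow> nat \<Rightarrow> ('a \<Rightarrow> nat) \<Rightarrow> bool" where
  "proper_coloring V E n f \<longleftrightarrow>
     f ` V \<subseteq> {..<n} \<and> (\<forall>u\<in>V. \<forall>v\<in>V. {u, v} \<in> E \<longrightarrow> f u \<noteq> f v)"

definition chromatic_number :: "'a set \<Rightarrow> 'a set set \<Rightarrow> nat" where
  "chromatic_number V E = (LEAST n. \<exists>f. proper_coloring V E n f)"

end

theory Submission
  imports Defs "HOL-Library.List_Lexorder"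
begin

text \<open>
  Order the curves by their height at the line \<open>l\<close>. On one side of \<open>l\<close>, if \<open>a\<close> is disjoint from and
  below \<open>b\<close>, and \<open>b\<close> from and below \<open>c\<close>, then \<open>a\<close> and \<open>c\<close> are disjoint unless \<open>b\<close> is shorter than both.
  Conversely, every relation with this property is realized by one-sided curves, and gluing the two
  sides intersects the two relations.

  Both relations are taken inside the Zykov graphs, seen as the covering relation of a poset whose
  intervals are chains: let \<open>a\<close> and \<open>b\<close> be related if no element between them is shorter than both.
  Covering pairs are related on both sides, which makes the chromatic number at least the number of
  levels. The lengths depend on the level only, and along a clique both length sequences have no
  valley. So it remains to find two length functions on \<open>(k+1)/2 * binom(k+2,3)\<close> levels with no \<open>k+1\<close>
  levels free of valleys on both sides. As the chromatic number drops by at most one when a curve is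
  deleted, the exact value is then attained by a subfamily.
\<close>

section \<open>Realizing relations by curves\<close>

lemma sorted_enumeration:
  fixes key :: "'a \<Rightarrow> 'b::linorder"
  assumes "finite V"
  shows "\<exists>f. bij_betw f {..<card V} V \<and> (\<forall>i j. i \<le> j \<and> j < card V \<longrightarrow> key (f i) \<le> key (f j))"
proof -
  obtain xs where xs: "set xs = V" "distinct xs"
    using assms finite_distinct_list by blast
  define ys where "ys = sort_key key xs"
  have ys: "set ys = V" "distinct ys" "sorted (map key ys)"
    by (simp_all add: ys_def xs)
  have len: "length ys = card V"
    using ys distinct_card by fastforce
  have "bij_betw ((!) ys) {..<card V} V"
    using ys len by (intro bij_betw_nth) auto
  moreover have "key (ys ! i) \<le> key (ys ! j)" if "i \<le> j" "j < card V" for i j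
    using ys(3) that len by (auto simp: sorted_iff_nth_mono)
  ultimately show ?thesis by blast
qed

text \<open>A bump of height 1 at \<open>i\<close>, zero from distance 1/2 on, so bumps at different
  integers do not overlap and at most one scheduled move is active at a time.\<close>

definition tent :: "nat \<Rightarrow> real \<Rightarrow> real" where
  "tent i x = max 0 (1 - 2 * \<bar>x - real i\<bar>)"

lemma continuous_on_tent: "continuous_on S (tent i)"
  unfolding tent_def by (intro continuous_intros)

lemma tent_nonneg: "0 \<le> tent i x"
  by (simp add: tent_def)

lemma tent_eq_0: "1 / 2 \<le> \<bar>x - real i\<bar> \<Longrightarrow> tent i x = 0"
  by (simp add: tent_def)

text \<open>The curve of \<open>v\<close> is the graph of \<open>g v\<close> over \<open>{0..e v}\<close>; \<open>E\<close> is "disjoint and below".\<close>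

definition realizes :: "'a set \<Rightarrow> ('a \<Rightarrow> 'a \<Rightarrow> bool) \<Rightarrow> ('a \<Rightarrow> real) \<Rightarrow>
    ('a \<Rightarrow> real \<Rightarrow> real) \<Rightarrow> ('a \<Rightarrow> real) \<Rightarrow> bool" where
  "realizes V E p g e \<longleftrightarrow>
     (\<forall>v. continuous_on UNIV (g v)) \<and> (\<forall>v. \<forall>x\<le>0. g v x = p v) \<and> (\<forall>v. 0 \<le> e v) \<and>
     (\<forall>a\<in>V. \<forall>b\<in>V. E a b \<longrightarrow> (\<forall>x. x \<le> e a \<and> x \<le> e b \<longrightarrow> g a x < g b x)) \<and>
     (\<forall>a\<in>V. \<forall>b\<in>V. \<not> E a b \<and> \<not> E b a \<longrightarrow>
       (\<exists>x\<ge>0. x \<le> e a \<and> x \<le> e b \<and> g a x = g b x))"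

lemma grounded_realization:
  fixes V :: "'a set" and p :: "'a \<Rightarrow> real" and len :: "'a \<Rightarrow> 'b::linorder"
  assumes fin: "finite V"
    and up: "\<And>a b. a \<in> V \<Longrightarrow> b \<in> V \<Longrightarrow> E a b \<Longrightarrow> p a < p b"
    and trans: "\<And>a b c. a \<in> V \<Longrightarrow> b \<in> V \<Longrightarrow> c \<in> V \<Longrightarrow> E a b \<Longrightarrow> E b c \<Longrightarrow>
      len a \<le> len b \<or> len c \<le> len b \<Longrightarrow> E a c"
  shows "\<exists>g e. realizes V E p g e"
proof -
  obtain f where f: "bij_betw f {..<card V} V"
    and f_mono: "\<And>i j. i \<le> j \<Longrightarrow> j < card V \<Longrightarrow> len (f i) \<le> len (f j)"
    using sorted_enumeration[OF fin, of len] by blast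
  \<comment> \<open>Rank by length: shortly before its end, the curve of rank \<open>i\<close> moves far up together with its upper
    neighbours (time \<open>2 i + 1\<close>), then far down together with its lower neighbours (time \<open>2 i + 2\<close>).
    By the transitivity hypothesis, related curves alive at that time never get closer than at the start.\<close>
  define idx where "idx = the_inv_into {..<card V} f"
  have idx: "idx v < card V" "f (idx v) = v" if "v \<in> V" for v
    using f that the_inv_into_into[of f "{..<card V}" v "{..<card V}"] f_the_inv_into_f[of f "{..<card V}" v]
    by (auto simp: idx_def bij_betw_def)
  have len_le: "len a \<le> len b" if "a \<in> V" "b \<in> V" "idx a \<le> idx b" for a b
    using f_mono[of "idx a" "idx b"] idx that by simp
  have idx_inj: "a = b" if "a \<in> V" "b \<in> V" "idx a = idx b" for a b
    using idx that by metis
  \<comment> \<open>Exceeds every difference of starting heights, so a move of amplitude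
    \<open>M\<close> can pass the start of any other curve.\<close>
  define M where "M = 1 + (\<Sum>v\<in>V. \<bar>p v\<bar>) * 2"
  have p_le: "\<bar>p v\<bar> \<le> (\<Sum>v\<in>V. \<bar>p v\<bar>)" if "v \<in> V" for v
    using fin that by (intro member_le_sum) auto
  have sum_nn: "0 \<le> (\<Sum>v\<in>V. \<bar>p v\<bar>)" by (intro sum_nonneg) auto
  then have M: "0 < M" unfolding M_def by linarith
  have M_ge: "p a - p b \<le> M" if "a \<in> V" "b \<in> V" for a b
    using p_le[OF that(1)] p_le[OF that(2)] unfolding M_def by linarith
  define rise where "rise u v = (if v = u \<or> E u v then M else 0)" for u v
  define sink where "sink u v = (if v = u \<or> E v u then M else 0)" for u v
  define g where "g v x = p v + (\<Sum>u\<in>V. tent (2 * idx u + 1) x * rise u v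
    - tent (2 * idx u + 2) x * sink u v)" for v x
  define e where "e v = real (2 * idx v + 2)" for v
  have meet: "\<exists>x\<ge>0. x \<le> e a \<and> x \<le> e b \<and> g a x = g b x"
    if ab: "a \<in> V" "b \<in> V" "\<not> E a b" "\<not> E b a" "idx a \<le> idx b" for a b
  proof (cases "a = b")
    case True
    then show ?thesis by (intro exI[of _ 0]) (simp add: e_def)
  next
    case neq: False
    \<comment> \<open>The fraction of a full move that brings \<open>a\<close> to the height of
      \<open>b\<close>. Below, \<open>j\<close> is the rise or the sink of \<open>a\<close>,
      whichever leads towards \<open>b\<close>, and \<open>x\<close> is the point on the rising
      flank of that bump where its value is \<open>t\<close>.\<close>
    define t where "t = \<bar>p b - p a\<bar> / M"
    have t: "0 \<le> t" "t \<le> 1"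
      using M M_ge[OF ab(1,2)] M_ge[OF ab(2,1)] by (auto simp: t_def)
    have tM: "t * M = \<bar>p b - p a\<bar>" using M by (simp add: t_def)
    define j where "j = (if p a \<le> p b then 2 * idx a + 1 else 2 * idx a + 2)"
    define x where "x = real j - (1 - t) / 2"
    have tent_j: "tent i x = (if i = j then t else 0)" for i
    proof (cases "i = j")
      case True
      then show ?thesis using t by (simp add: tent_def x_def field_simps)
    next
      case False
      then have "1 \<le> \<bar>real j - real i\<bar>" by linarith
      then have "1 / 2 \<le> \<bar>x - real i\<bar>" using t by (simp add: x_def field_simps)
      then show ?thesis using False tent_eq_0 by simp
    qed
    \<comment> \<open>Only a bump of \<open>a\<close> can be active at \<open>x\<close>; being
      unrelated to \<open>a\<close>, the curve of \<open>b\<close> takes no part in it.\<close>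
    have b: "tent (2 * idx u + 1) x * rise u b - tent (2 * idx u + 2) x * sink u b = 0"
      if "u \<in> V" for u
    proof (cases "u = a")
      case True
      then show ?thesis using ab neq by (simp add: rise_def sink_def)
    next
      case False
      then have "idx u \<noteq> idx a" using idx_inj that ab(1) by blast
      then have "2 * idx u + 1 \<noteq> j" "2 * idx u + 2 \<noteq> j"
        by (auto simp: j_def; presburger)+
      then show ?thesis by (simp add: tent_j)
    qed
    have a: "tent (2 * idx u + 1) x * rise u a - tent (2 * idx u + 2) x * sink u a
      = (if u = a then p b - p a else 0)" if "u \<in> V" for u
    proof (cases "u = a")
      case True
      have "2 * idx a + 1 \<noteq> 2 * idx a + 2" by simp
      then show ?thesis using True tM by (auto simp: rise_def sink_def tent_j j_def)
    next
      case False
      then have "idx u \<noteq> idx a" using idx_inj that ab(1) by blast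
      then have "2 * idx u + 1 \<noteq> j" "2 * idx u + 2 \<noteq> j"
        by (auto simp: j_def; presburger)+
      then show ?thesis using False by (simp add: tent_j)
    qed
    have "g b x = p b" unfolding g_def using b by simp
    moreover have "g a x = p a + (\<Sum>u\<in>V. if u = a then p b - p a else 0)"
      unfolding g_def using a by (simp cong: sum.cong)
    then have "g a x = p b" using fin ab(1) by simp
    moreover have "1 \<le> j" "j \<le> 2 * idx a + 2" by (auto simp: j_def)
    then have "0 \<le> x" "x \<le> e a" using t by (auto simp: x_def e_def field_simps)
    moreover have "e a \<le> e b" using ab by (simp add: e_def)
    ultimately show ?thesis by (intro exI[of _ x]) auto
  qed
  have 1: "continuous_on UNIV (g v)" for v
    unfolding g_def by (intro continuous_intros continuous_on_tent)
  have 2: "g v x = p v" if "x \<le> 0" for v x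
    unfolding g_def using that by (auto simp: tent_eq_0 intro!: sum.neutral)
  have 3: "0 \<le> e v" for v by (simp add: e_def)
  have 4: "g a x < g b x" if ab: "a \<in> V" "b \<in> V" "E a b" and x: "x \<le> e a" "x \<le> e b" for a b x
  proof -
    have "tent (2 * idx u + 1) x * rise u a - tent (2 * idx u + 2) x * sink u a
      \<le> tent (2 * idx u + 1) x * rise u b - tent (2 * idx u + 2) x * sink u b"
      if u: "u \<in> V" for u
    proof (cases "idx u \<le> idx a \<and> idx u \<le> idx b")
      case True
      \<comment> \<open>By \<open>trans\<close>, a move that lifts \<open>a\<close> also lifts
        \<open>b\<close>, and one that lowers \<open>b\<close> also lowers \<open>a\<close>.\<close>
      then have "len u \<le> len a" "len u \<le> len b" using len_le ab u by auto
      then have "rise u a \<le> rise u b" "sink u b \<le> sink u a"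
        using ab u trans[of u a b] trans[of a b u] M by (auto simp: rise_def sink_def)
      then show ?thesis
        by (intro diff_mono mult_left_mono tent_nonneg)
    next
      case False
      \<comment> \<open>Here \<open>u\<close> outranks \<open>a\<close> or \<open>b\<close>, so its
        moves begin only after the end of that curve.\<close>
      then have "x + 1 / 2 \<le> real (2 * idx u + 1)"
        using x by (auto simp: e_def)
      then have "tent (2 * idx u + 1) x = 0" "tent (2 * idx u + 2) x = 0"
        by (auto intro!: tent_eq_0)
      then show ?thesis by simp
    qed
    then show ?thesis
      unfolding g_def using up[OF ab] by (intro add_less_le_mono sum_mono) auto
  qed
  have 5: "\<exists>x\<ge>0. x \<le> e a \<and> x \<le> e b \<and> g a x = g b x"
    if "a \<in> V" "b \<in> V" "\<not> E a b" "\<not> E b a" for a b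
  proof (cases "idx a \<le> idx b")
    case True
    then show ?thesis using meet that by blast
  next
    case False
    then have "\<exists>x\<ge>0. x \<le> e b \<and> x \<le> e a \<and> g b x = g a x" using meet[of b a] that by auto
    then show ?thesis by metis
  qed
  have "realizes V E p g e"
    unfolding realizes_def using 1 2 3 4 5 by simp
  then show ?thesis by blast
qed

section \<open>Joining the two sides along the line\<close>

lemma graph_is_curve:
  fixes F :: "real \<Rightarrow> real"
  assumes "continuous_on UNIV F" "lo \<le> hi"
  shows "curve ((\<lambda>x. (x, F x)) ` {lo..hi})" and "x_monotone ((\<lambda>x. (x, F x)) ` {lo..hi})"
proof -
  have "path ((\<lambda>x. (x, F x)) \<circ> linepath lo hi)"
    using assms by (intro path_continuous_image continuous_intros continuous_on_subset[OF assms(1)]) auto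
  then show "curve ((\<lambda>x. (x, F x)) ` {lo..hi})"
    unfolding curve_def using assms(2)
    by (metis path_image_compose path_image_linepath closed_segment_eq_real_ivl)
  show "x_monotone ((\<lambda>x. (x, F x)) ` {lo..hi})"
    by (auto simp: x_monotone_def vertical_line_def)
qed

text \<open>Reflect the first one-sided realization and join it to the second at the common heights
  \<open>p\<close>. Disjoint curves must be related on each side, and the two relations cannot point
  in opposite directions because both increase \<open>p\<close>.\<close>

lemma two_sided_realization:
  fixes V :: "'a set" and p :: "'a \<Rightarrow> real" and len\<^sub>1 len\<^sub>2 :: "'a \<Rightarrow> 'b::linorder"
  assumes fin: "finite V"
    and up: "\<And>a b. a \<in> V \<Longrightarrow> b \<in> V \<Longrightarrow> E\<^sub>1 a b \<or> E\<^sub>2 a b \<Longrightarrow> p a < p b"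
    and trans\<^sub>1: "\<And>a b c. a \<in> V \<Longrightarrow> b \<in> V \<Longrightarrow> c \<in> V \<Longrightarrow> E\<^sub>1 a b \<Longrightarrow> E\<^sub>1 b c \<Longrightarrow>
      len\<^sub>1 a \<le> len\<^sub>1 b \<or> len\<^sub>1 c \<le> len\<^sub>1 b \<Longrightarrow> E\<^sub>1 a c"
    and trans\<^sub>2: "\<And>a b c. a \<in> V \<Longrightarrow> b \<in> V \<Longrightarrow> c \<in> V \<Longrightarrow> E\<^sub>2 a b \<Longrightarrow> E\<^sub>2 b c \<Longrightarrow>
      len\<^sub>2 a \<le> len\<^sub>2 b \<or> len\<^sub>2 c \<le> len\<^sub>2 b \<Longrightarrow> E\<^sub>2 a c"
  shows "\<exists>C. (\<forall>v. curve (C v) \<and> x_monotone (C v) \<and> C v \<inter> {q. fst q = 0} \<noteq> {}) \<and>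
    (\<forall>a\<in>V. \<forall>b\<in>V. C a \<inter> C b = {} \<longleftrightarrow> E\<^sub>1 a b \<and> E\<^sub>2 a b \<or> E\<^sub>1 b a \<and> E\<^sub>2 b a)"
proof -
  have up\<^sub>1: "\<And>a b. a \<in> V \<Longrightarrow> b \<in> V \<Longrightarrow> E\<^sub>1 a b \<Longrightarrow> p a < p b"
    and up\<^sub>2: "\<And>a b. a \<in> V \<Longrightarrow> b \<in> V \<Longrightarrow> E\<^sub>2 a b \<Longrightarrow> p a < p b"
    using up by auto
  obtain g\<^sub>1 e\<^sub>1 where "realizes V E\<^sub>1 p g\<^sub>1 e\<^sub>1"
    using grounded_realization[of V E\<^sub>1 p len\<^sub>1] fin up\<^sub>1 trans\<^sub>1 by blast
  then have 1: "\<And>v. continuous_on UNIV (g\<^sub>1 v)" "\<And>v x. x \<le> 0 \<Longrightarrow> g\<^sub>1 v x = p v"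
    "\<And>v. 0 \<le> e\<^sub>1 v"
    "\<And>a b x. a \<in> V \<Longrightarrow> b \<in> V \<Longrightarrow> E\<^sub>1 a b \<Longrightarrow> x \<le> e\<^sub>1 a \<Longrightarrow> x \<le> e\<^sub>1 b \<Longrightarrow> g\<^sub>1 a x < g\<^sub>1 b x"
    "\<And>a b. a \<in> V \<Longrightarrow> b \<in> V \<Longrightarrow> \<not> E\<^sub>1 a b \<Longrightarrow> \<not> E\<^sub>1 b a \<Longrightarrow>
      \<exists>x\<ge>0. x \<le> e\<^sub>1 a \<and> x \<le> e\<^sub>1 b \<and> g\<^sub>1 a x = g\<^sub>1 b x"
    by (simp_all add: realizes_def)
  obtain g\<^sub>2 e\<^sub>2 where "realizes V E\<^sub>2 p g\<^sub>2 e\<^sub>2"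
    using grounded_realization[of V E\<^sub>2 p len\<^sub>2] fin up\<^sub>2 trans\<^sub>2 by blast
  then have 2: "\<And>v. continuous_on UNIV (g\<^sub>2 v)" "\<And>v x. x \<le> 0 \<Longrightarrow> g\<^sub>2 v x = p v"
    "\<And>v. 0 \<le> e\<^sub>2 v"
    "\<And>a b x. a \<in> V \<Longrightarrow> b \<in> V \<Longrightarrow> E\<^sub>2 a b \<Longrightarrow> x \<le> e\<^sub>2 a \<Longrightarrow> x \<le> e\<^sub>2 b \<Longrightarrow> g\<^sub>2 a x < g\<^sub>2 b x"
    "\<And>a b. a \<in> V \<Longrightarrow> b \<in> V \<Longrightarrow> \<not> E\<^sub>2 a b \<Longrightarrow> \<not> E\<^sub>2 b a \<Longrightarrow>
      \<exists>x\<ge>0. x \<le> e\<^sub>2 a \<and> x \<le> e\<^sub>2 b \<and> g\<^sub>2 a x = g\<^sub>2 b x"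
    by (simp_all add: realizes_def)
  \<comment> \<open>Each \<open>g\<close> term equals \<open>p v\<close> on the other half-line, so
    this is the glued function without a case distinction, and continuity is immediate.\<close>
  define F where "F v x = g\<^sub>1 v (- x) + g\<^sub>2 v x - p v" for v x
  have F_neg: "F v x = g\<^sub>1 v (- x)" if "x \<le> 0" for v x
    using 2(2) that by (simp add: F_def)
  have F_pos: "F v x = g\<^sub>2 v x" if "0 \<le> x" for v x
    using 1(2)[of "- x"] that by (simp add: F_def)
  have F_cont: "continuous_on UNIV (F v)" for v
    unfolding F_def
    by (intro continuous_intros continuous_on_compose2[OF 1(1)] continuous_on_compose2[OF 2(1)]) auto
  define C where "C v = (\<lambda>x. (x, F v x)) ` {- e\<^sub>1 v..e\<^sub>2 v}" for v
  have ends: "- e\<^sub>1 v \<le> 0" "0 \<le> e\<^sub>2 v" for v using 1(3) 2(3) by auto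
  have disj: "C a \<inter> C b = {} \<longleftrightarrow> (\<forall>x. - e\<^sub>1 a \<le> x \<and> - e\<^sub>1 b \<le> x \<and> x \<le> e\<^sub>2 a \<and> x \<le> e\<^sub>2 b \<longrightarrow> F a x \<noteq> F b x)" for a b
    unfolding C_def disjoint_iff by (auto simp: image_iff)
  have less: "C a \<inter> C b = {}" if "a \<in> V" "b \<in> V" "E\<^sub>1 a b" "E\<^sub>2 a b" for a b
    unfolding disj
  proof (intro allI impI)
    fix x assume x: "- e\<^sub>1 a \<le> x \<and> - e\<^sub>1 b \<le> x \<and> x \<le> e\<^sub>2 a \<and> x \<le> e\<^sub>2 b"
    show "F a x \<noteq> F b x"
    proof (cases "x \<le> 0")
      case True
      then show ?thesis using 1(4)[OF that(1-3), of "- x"] x F_neg by simp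
    next
      case False
      then show ?thesis using 2(4)[OF that(1,2,4), of x] x F_pos by simp
    qed
  qed
  have sym: "E\<^sub>1 a b \<or> E\<^sub>1 b a" "E\<^sub>2 a b \<or> E\<^sub>2 b a" if ab: "a \<in> V" "b \<in> V" "C a \<inter> C b = {}" for a b
  proof -
    show "E\<^sub>1 a b \<or> E\<^sub>1 b a"
    proof (rule ccontr)
      assume "\<not> (E\<^sub>1 a b \<or> E\<^sub>1 b a)"
      then obtain x where x: "0 \<le> x" "x \<le> e\<^sub>1 a" "x \<le> e\<^sub>1 b" "g\<^sub>1 a x = g\<^sub>1 b x"
        using 1(5) ab by blast
      moreover have "- x \<le> e\<^sub>2 a" "- x \<le> e\<^sub>2 b" using ends[of a] ends[of b] x(1) by linarith+
      ultimately show False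
        using ab(3)[unfolded disj, rule_format, of "- x"] F_neg[of "- x"] by simp
    qed
    show "E\<^sub>2 a b \<or> E\<^sub>2 b a"
    proof (rule ccontr)
      assume "\<not> (E\<^sub>2 a b \<or> E\<^sub>2 b a)"
      then obtain x where x: "0 \<le> x" "x \<le> e\<^sub>2 a" "x \<le> e\<^sub>2 b" "g\<^sub>2 a x = g\<^sub>2 b x"
        using 2(5) ab by blast
      moreover have "- e\<^sub>1 a \<le> x" "- e\<^sub>1 b \<le> x" using ends[of a] ends[of b] x(1) by linarith+
      ultimately show False
        using ab(3)[unfolded disj, rule_format, of x] F_pos[of x] by simp
    qed
  qed
  have 1: "curve (C v)" "x_monotone (C v)" for v
    unfolding C_def using graph_is_curve[OF F_cont order_trans[OF ends]] by blast+
  have 2: "C v \<inter> {q. fst q = 0} \<noteq> {}" for v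
  proof -
    have "(0, F v 0) \<in> C v" unfolding C_def using ends[of v] by (intro image_eqI[of _ _ 0]) auto
    then show ?thesis by auto
  qed
  have 3: "C a \<inter> C b = {} \<longleftrightarrow> E\<^sub>1 a b \<and> E\<^sub>2 a b \<or> E\<^sub>1 b a \<and> E\<^sub>2 b a" if "a \<in> V" "b \<in> V" for a b
  proof
    assume "C a \<inter> C b = {}"
    then have "E\<^sub>1 a b \<or> E\<^sub>1 b a" "E\<^sub>2 a b \<or> E\<^sub>2 b a" using sym that by auto
    moreover have "\<not> ((E\<^sub>1 a b \<or> E\<^sub>2 a b) \<and> (E\<^sub>1 b a \<or> E\<^sub>2 b a))"
      using up[of a b] up[of b a] that by force
    ultimately show "E\<^sub>1 a b \<and> E\<^sub>2 a b \<or> E\<^sub>1 b a \<and> E\<^sub>2 b a" by blast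
  next
    assume "E\<^sub>1 a b \<and> E\<^sub>2 a b \<or> E\<^sub>1 b a \<and> E\<^sub>2 b a"
    then show "C a \<inter> C b = {}" using less[of a b] less[of b a] that by blast
  qed
  show ?thesis
    using 1 2 3 by (intro exI[of _ C]) simp
qed

section \<open>Zykov graphs as posets\<close>

text \<open>\<open>Zykov (Suc n)\<close> consists of \<open>n\<close> copies of \<open>Zykov n\<close> and, for each choice \<open>ws\<close> of one vertex per copy,
  an apex above the chosen vertices.\<close>

datatype zykov = Apex "zykov list" | Copy nat zykov

primrec level :: "zykov \<Rightarrow> nat" where
  "level (Apex ws) = length ws"
| "level (Copy i v) = level v"

text \<open>Written in transitively closed form; the edges of the Zykov graph are recovered as the
  covering pairs.\<close>

fun prec :: "zykov \<Rightarrow> zykov \<Rightarrow> bool" where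
  "prec (Copy i u) (Copy j v) \<longleftrightarrow> i = j \<and> prec u v"
| "prec (Copy i u) (Apex ws) \<longleftrightarrow> i < length ws \<and> (u = ws ! i \<or> prec u (ws ! i))"
| "prec (Apex ws) v \<longleftrightarrow> False"

definition covers :: "zykov \<Rightarrow> zykov \<Rightarrow> bool" where
  "covers u v \<longleftrightarrow> prec u v \<and> \<not> (\<exists>z. prec u z \<and> prec z v)"

primrec Zykov :: "nat \<Rightarrow> zykov set" where
  "Zykov 0 = {}"
| "Zykov (Suc n) = (\<Union>i<n. Copy i ` Zykov n) \<union> Apex ` {ws. set ws \<subseteq> Zykov n \<and> length ws = n}"

lemma finite_Zykov: "finite (Zykov n)"
  by (induction n) (auto intro: finite_lists_length_eq)

lemma level_less: "v \<in> Zykov n \<Longrightarrow> level v < n"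
  by (induction n arbitrary: v) (auto intro: less_SucI)

lemma prec_level: "u \<in> Zykov n \<Longrightarrow> v \<in> Zykov n \<Longrightarrow> prec u v \<Longrightarrow> level u < level v"
  by (induction n arbitrary: u v) (auto simp: level_less)

lemma prec_irrefl: "\<not> prec v v"
  by (induction v) auto

lemma prec_trans: "prec a b \<Longrightarrow> prec b c \<Longrightarrow> prec a c"
proof (induction a arbitrary: b c)
  case (Copy i a)
  then show ?case by (cases b; cases c) auto
qed simp

text \<open>Between a vertex of a copy and an apex, everything lies in that copy, at or below its
  chosen vertex. So the claim descends into the copy.\<close>

lemma prec_interval_chain:
  "prec a b \<Longrightarrow> prec a d \<Longrightarrow> prec b c \<Longrightarrow> prec d c \<Longrightarrow> b = d \<or> prec b d \<or> prec d b"
proof (induction a arbitrary: b c d)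
  case (Copy i a)
  then show ?case by (cases b; cases c; cases d) auto
qed simp

lemma covers_Copy:
  assumes "covers u v"
  shows "covers (Copy i u) (Copy i v)"
proof -
  have "\<not> (prec (Copy i u) z \<and> prec z (Copy i v))" for z
    using assms by (cases z) (auto simp: covers_def)
  then show ?thesis using assms by (auto simp: covers_def)
qed

lemma covers_Apex:
  assumes "i < length ws"
  shows "covers (Copy i (ws ! i)) (Apex ws)"
proof -
  have "\<not> (prec (Copy i (ws ! i)) z \<and> prec z (Apex ws))" for z
    using prec_trans prec_irrefl by (cases z) auto
  then show ?thesis using assms by (auto simp: covers_def)
qed

text \<open>Counting the colors that occur, not those available, makes the induction hypothesis
  apply directly to each copy.\<close>

lemma card_colors_Zykov:
  assumes "\<And>u v. u \<in> Zykov n \<Longrightarrow> v \<in> Zykov n \<Longrightarrow> covers u v \<Longrightarrow> f u \<noteq> f v"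
  shows "n \<le> card (f ` Zykov n)"
  using assms
proof (induction n arbitrary: f)
  case (Suc n)
  have copy: "n \<le> card ((\<lambda>v. f (Copy i v)) ` Zykov n)" if "i < n" for i
  proof (rule Suc.IH)
    fix u v assume "u \<in> Zykov n" "v \<in> Zykov n" "covers u v"
    then show "f (Copy i u) \<noteq> f (Copy i v)"
      using that covers_Copy by (intro Suc.prems) auto
  qed
  \<comment> \<open>Choose vertices of pairwise distinct colors in the copies; their apex needs a further color.\<close>
  have "\<exists>ws. length ws = m \<and> set ws \<subseteq> Zykov n \<and> card ((\<lambda>i. f (Copy i (ws ! i))) ` {..<m}) = m"
    if "m \<le> n" for m
    using that
  proof (induction m)
    case (Suc m)
    then obtain ws where ws: "length ws = m" "set ws \<subseteq> Zykov n"
      "card ((\<lambda>i. f (Copy i (ws ! i))) ` {..<m}) = m" by auto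
    \<comment> \<open>At least \<open>n > m\<close> colors occur in copy \<open>m\<close>, so one of
      them differs from the \<open>m\<close> colors already collected.\<close>
    have "\<not> (\<lambda>v. f (Copy m v)) ` Zykov n \<subseteq> (\<lambda>i. f (Copy i (ws ! i))) ` {..<m}"
      using card_mono[of "(\<lambda>i. f (Copy i (ws ! i))) ` {..<m}" "(\<lambda>v. f (Copy m v)) ` Zykov n"]
        copy[of m] ws(3) Suc.prems by auto
    then obtain v where v: "v \<in> Zykov n" "f (Copy m v) \<notin> (\<lambda>i. f (Copy i (ws ! i))) ` {..<m}"
      by blast
    have eq: "(\<lambda>i. f (Copy i ((ws @ [v]) ! i))) ` {..<Suc m}
      = insert (f (Copy m v)) ((\<lambda>i. f (Copy i (ws ! i))) ` {..<m})"
      using ws(1) by (auto simp: lessThan_Suc nth_append)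
    show ?case
      using ws v unfolding eq by (intro exI[of _ "ws @ [v]"]) (simp add: eq)
  qed simp
  then obtain ws where ws: "length ws = n" "set ws \<subseteq> Zykov n"
    "card ((\<lambda>i. f (Copy i (ws ! i))) ` {..<n}) = n" by blast
  have nth: "ws ! i \<in> Zykov n" if "i < n" for i using ws that by auto
  have apex: "Apex ws \<in> Zykov (Suc n)" using ws by auto
  have copies: "Copy i (ws ! i) \<in> Zykov (Suc n)" if "i < n" for i using nth that by auto
  have "f (Copy i (ws ! i)) \<noteq> f (Apex ws)" if "i < n" for i
    using Suc.prems[OF copies apex] covers_Apex ws(1) that by blast
  then have "f (Apex ws) \<notin> (\<lambda>i. f (Copy i (ws ! i))) ` {..<n}"
    by force
  then have "Suc n = card (insert (f (Apex ws)) ((\<lambda>i. f (Copy i (ws ! i))) ` {..<n}))"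
    using ws(3) by simp
  also have "\<dots> \<le> card (f ` Zykov (Suc n))"
    using apex copies by (intro card_mono finite_imageI finite_Zykov) (auto simp del: Zykov.simps)
  finally show ?case .
qed simp

section \<open>Two length functions without long valley-free sets\<close>

text \<open>Levels, ordered by \<open>ykey\<close>, are arranged in blocks \<open>(i, m)\<close> of size \<open>(m + 1)\<^sup>2\<close>; \<open>lkey\<close> and \<open>rkey\<close> are the
  lengths on the two sides. They agree on the order of the blocks and are opposite inside a block,
  where the arrangement is the extremal one of Erdos and Szekeres.\<close>

definition classes :: "nat \<Rightarrow> (nat \<times> nat \<times> nat \<times> nat) set" where
  "classes k = (SIGMA i:{..<k}. SIGMA m:{..i}. {..m} \<times> {..m})"

fun ykey lkey rkey :: "nat \<times> nat \<times> nat \<times> nat \<Rightarrow> int list" where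
  "ykey (i, m, c, d) = [int i, - int m, int c, - int d]"
| "lkey (i, m, c, d) = [- int i, - int m, int c, int d]"
| "rkey (i, m, c, d) = [- int i, - int m, - int c, - int d]"

lemma finite_classes: "finite (classes k)"
  unfolding classes_def by (intro finite_SigmaI) auto

lemma inj_ykey: "inj ykey"
  by (auto simp: inj_def)

lemma card_classes_sum: "card (classes k) = (\<Sum>i<k. \<Sum>m\<le>i. (m + 1)\<^sup>2)"
  by (simp add: classes_def card_SigmaI card_cartesian_product power2_eq_square)

text \<open>Leaves enough colors for a clique of size \<open>k\<close>, which has to survive the
  final deletion of curves.\<close>

lemma le_card_classes: "k \<le> card (classes k)"
proof -
  have "(\<Sum>i<k. 1::nat) \<le> (\<Sum>i<k. \<Sum>m\<le>i. (m + 1)\<^sup>2)"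
  proof (rule sum_mono)
    show "1 \<le> (\<Sum>m\<le>i. (m + 1)\<^sup>2)" for i :: nat
      using member_le_sum[of 0 "{..i}" "\<lambda>m. (m + 1)\<^sup>2"] by simp
  qed
  then show ?thesis by (simp add: card_classes_sum)
qed

lemma card_classes:
  "real (card (classes k)) = (real k + 1) / 2 * real ((k + 2) choose 3)"
proof -
  have sq: "real (\<Sum>m\<le>i. (m + 1)\<^sup>2) = (real i + 1) * (real i + 2) * (2 * real i + 3) / 6" for i
    by (induction i) (simp_all add: field_simps power2_eq_square)
  have ch: "real ((n + 2) choose 3) = real n * (real n + 1) * (real n + 2) / 6" for n
  proof (induction n)
    case (Suc n)
    have "real ((n + 2) choose 2) = (real n + 2) * (real n + 1) / 2"
      by (induction n) (simp_all add: numeral_2_eq_2 field_simps)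
    then show ?case using Suc by (simp add: numeral_3_eq_3 numeral_2_eq_2 field_simps)
  qed (simp add: numeral_3_eq_3)
  have "real (card (classes k)) = real k * (real k + 1)\<^sup>2 * (real k + 2) / 12"
  proof -
    have "real (card (classes k)) = (\<Sum>i<k. (real i + 1) * (real i + 2) * (2 * real i + 3) / 6)"
      unfolding card_classes_sum by (subst of_nat_sum) (simp only: sq)
    also have "\<dots> = real k * (real k + 1)\<^sup>2 * (real k + 2) / 12"
      by (induction k) (simp_all add: field_simps power2_eq_square)
    finally show ?thesis .
  qed
  then show ?thesis unfolding ch by (simp add: field_simps power2_eq_square)
qed

text \<open>By injectivity of \<open>ykey\<close>, two distinct elements with equal image can be put
  in \<open>ykey\<close> order, where the valley condition applies.\<close>

lemma inj_on_if_ykey: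
  assumes "\<And>a b. a \<in> A \<Longrightarrow> b \<in> A \<Longrightarrow> f a = f b \<Longrightarrow> ykey a < ykey b \<Longrightarrow> False"
  shows "inj_on f A"
proof (intro inj_onI)
  fix a b assume "a \<in> A" "b \<in> A" "f a = f b"
  then have "\<not> ykey a < ykey b" "\<not> ykey b < ykey a"
    using assms[of a b] assms[of b a] by auto
  then have "ykey a = ykey b" by (simp add: not_less)
  then show "a = b" using inj_ykey by (simp add: inj_eq)
qed

lemma card_no_valley_le:
  assumes X: "X \<subseteq> classes k"
    and no_valley: "\<And>a b c. a \<in> X \<Longrightarrow> b \<in> X \<Longrightarrow> c \<in> X \<Longrightarrow> ykey a < ykey b \<Longrightarrow> ykey b < ykey c \<Longrightarrow>
      (lkey a \<le> lkey b \<or> lkey c \<le> lkey b) \<and> (rkey a \<le> rkey b \<or> rkey c \<le> rkey b)"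
  shows "card X \<le> k"
proof (cases "X = {}")
  case False
  define blk :: "nat \<times> nat \<times> nat \<times> nat \<Rightarrow> nat list" where "blk = (\<lambda>(i, m, c, d). [i, m])"
  have fin: "finite X" using X finite_classes finite_subset by blast
  \<comment> \<open>\<open>q\<close> lies in the longest block of \<open>X\<close>. Before it, \<open>X\<close> increases on both sides, hence has at most one
    element per block and these have \<open>i = i0\<close>, \<open>m > m0\<close>; after it, dually, the values \<open>i > i0\<close> are distinct.
    Inside the block, \<open>X\<close> is monotone.\<close>
  have "Min (blk ` X) \<in> blk ` X" using fin False by simp
  then obtain q where q: "q \<in> X" "blk q = Min (blk ` X)" by auto
  obtain i0 m0 c0 d0 where q_eq: "q = (i0, m0, c0, d0)" by (cases q)
  have min: "i0 < i \<or> i0 = i \<and> m0 \<le> m" if "(i, m, c, d) \<in> X" for i m c d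
  proof -
    have "blk q \<le> blk (i, m, c, d)" using q(2) that fin by simp
    then show ?thesis by (auto simp: blk_def q_eq)
  qed
  have rng: "m0 \<le> i0" "i0 < k" using q(1) X by (auto simp: q_eq classes_def)
  define A where "A = {(i, m, c, d) \<in> X. i0 < i}"
  define B where "B = {(i, m, c, d) \<in> X. i = i0 \<and> m0 < m}"
  define P where "P = {(i, m, c, d) \<in> X. i = i0 \<and> m = m0}"
  have "X \<subseteq> A \<union> B \<union> P" using min unfolding A_def B_def P_def by fastforce
  moreover have "A \<union> B \<union> P \<subseteq> X" by (auto simp: A_def B_def P_def)
  ultimately have X_eq: "X = A \<union> B \<union> P" by blast
  \<comment> \<open>Since \<open>a\<close> is shorter than \<open>q\<close> on both sides,
    \<open>b\<close> would have to be at most as long as \<open>a\<close> on both; for equal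
    \<open>i\<close> this fails on at least one side.\<close>
  have "False" if "a \<in> A" "b \<in> A" "fst a = fst b" "ykey a < ykey b" for a b
    using no_valley[OF q(1), of a b] that by (cases a; cases b) (auto simp: A_def q_eq)
  then have "inj_on fst A" by (rule inj_on_if_ykey)
  moreover have "fst ` A \<subseteq> {i0<..<k}" using X by (auto simp: A_def classes_def)
  ultimately have A: "card A \<le> k - Suc i0"
    using card_inj_on_le[of fst A "{i0<..<k}"] by simp
  have "False" if "a \<in> B" "b \<in> B" "(fst \<circ> snd) a = (fst \<circ> snd) b" "ykey a < ykey b" for a b
    using no_valley[OF _ _ q(1), of a b] that by (cases a; cases b) (auto simp: B_def q_eq)
  then have "inj_on (fst \<circ> snd) B" by (rule inj_on_if_ykey)
  moreover have "(fst \<circ> snd) ` B \<subseteq> {m0<..i0}" using X by (auto simp: B_def classes_def)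
  ultimately have B: "card B \<le> i0 - m0"
    using card_inj_on_le[of "fst \<circ> snd" B "{m0<..i0}"] by simp
  have P_img: "(fst \<circ> snd \<circ> snd) ` P \<subseteq> {..m0}" "(snd \<circ> snd \<circ> snd) ` P \<subseteq> {..m0}"
    using X by (auto simp: P_def classes_def)
  \<comment> \<open>Two elements with the same \<open>c\<close> and a third with another
    \<open>c\<close> form a valley: in \<open>lkey\<close> if the third \<open>c\<close> is larger,
    in \<open>rkey\<close> if it is smaller. So either no \<open>c\<close> repeats, or
    \<open>c\<close> is constant and \<open>d\<close> is injective.\<close>
  have "inj_on (fst \<circ> snd \<circ> snd) P \<or> inj_on (snd \<circ> snd \<circ> snd) P"
  proof (rule ccontr)
    assume "\<not> ?thesis"
    then obtain a b a' b' where ab: "a \<in> P" "b \<in> P" "a \<noteq> b" "(fst \<circ> snd \<circ> snd) a = (fst \<circ> snd \<circ> snd) b"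
      and ab': "a' \<in> P" "b' \<in> P" "a' \<noteq> b'" "(snd \<circ> snd \<circ> snd) a' = (snd \<circ> snd \<circ> snd) b'"
      unfolding inj_on_def by blast
    obtain c d d' where c: "a = (i0, m0, c, d)" "b = (i0, m0, c, d')" "d \<noteq> d'"
      using ab by (cases a; cases b) (auto simp: P_def)
    obtain x x' y where "a' = (i0, m0, x, y)" "b' = (i0, m0, x', y)" "x \<noteq> x'"
      using ab' by (cases a'; cases b') (auto simp: P_def)
    then obtain z x y where z: "z \<in> P" "z = (i0, m0, x, y)" "x \<noteq> c"
      using ab'(1,2) by metis
    have nv: "(lkey a \<le> lkey b \<or> lkey c \<le> lkey b) \<and> (rkey a \<le> rkey b \<or> rkey c \<le> rkey b)"
      if "a \<in> P" "b \<in> P" "c \<in> P" "ykey a < ykey b" "ykey b < ykey c" for a b c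
      using no_valley[of a b c] that by (auto simp: P_def)
    show False
      using nv[of a b z] nv[of b a z] nv[of z a b] nv[of z b a] ab(1,2) z c
        linorder_less_linear[of d d'] linorder_less_linear[of x c]
      by auto
  qed
  then have P: "card P \<le> Suc m0"
    using card_inj_on_le[OF _ P_img(1)] card_inj_on_le[OF _ P_img(2)] by auto
  have "card X \<le> card A + card B + card P"
    unfolding X_eq by (meson card_Un_le le_trans add_le_mono1)
  \<comment> \<open>The three bounds add up to exactly \<open>k\<close>.\<close>
  then show ?thesis using A B P rng by linarith
qed simp

section \<open>The extremal family\<close>

definition below :: "(zykov \<Rightarrow> 'b::linorder) \<Rightarrow> zykov \<Rightarrow> zykov \<Rightarrow> bool" where
  "below w a b \<longleftrightarrow> prec a b \<and> (\<forall>z. prec a z \<and> prec z b \<longrightarrow> w a \<le> w z \<or> w b \<le> w z)"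

text \<open>As intervals are chains, any \<open>z\<close> between \<open>a\<close> and
  \<open>c\<close> is \<open>b\<close> or comparable to it. If \<open>z\<close> is only known to be
  at least as long as \<open>b\<close>, the last assumption passes this on to \<open>a\<close> or
  \<open>c\<close>.\<close>

lemma below_trans:
  assumes "below w a b" "below w b c" "w a \<le> w b \<or> w c \<le> w b"
  shows "below w a c"
  unfolding below_def
proof (intro conjI allI impI; (elim conjE)?)
  show "prec a c" using assms prec_trans by (auto simp: below_def)
  fix z assume z: "prec a z" "prec z c"
  then have "z = b \<or> prec z b \<or> prec b z"
    using prec_interval_chain[of a z b c] z assms by (auto simp: below_def)
  moreover have "w a \<le> w z \<or> w b \<le> w z" if "prec z b"
    using assms(1) z that by (auto simp: below_def)
  moreover have "w b \<le> w z \<or> w c \<le> w z" if "prec b z"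
    using assms(2) z that by (auto simp: below_def)
  ultimately show "w a \<le> w z \<or> w c \<le> w z"
    using assms(3) by (metis order_trans)
qed

lemma covers_below: "covers a b \<Longrightarrow> below w a b"
  by (auto simp: covers_def below_def)

definition crossing_family :: "(real \<times> real) set set \<Rightarrow> bool" where
  "crossing_family \<C> \<longleftrightarrow> finite \<C> \<and>
     (\<forall>C\<in>\<C>. curve C \<and> x_monotone C \<and> C \<inter> {q. fst q = 0} \<noteq> {})"

lemma extremal_family:
  obtains \<C> where "crossing_family \<C>"
    and "\<And>K. K \<subseteq> \<C> \<Longrightarrow> disjoint K \<Longrightarrow> card K \<le> k"
    and "\<And>f :: _ \<Rightarrow> nat. (\<And>A B. A \<in> \<C> \<Longrightarrow> B \<in> \<C> \<Longrightarrow> A \<inter> B = {} \<Longrightarrow> f A \<noteq> f B) \<Longrightarrow>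
      card (classes k) \<le> card (f ` \<C>)"
proof -
  define n where "n = card (classes k)"
  define V where "V = Zykov n"
  \<comment> \<open>Level \<open>i\<close> receives the \<open>i\<close>-th class in
    \<open>ykey\<close> order, so the order of levels along a clique becomes the \<open>ykey\<close>
    order of classes.\<close>
  obtain cl where bij: "bij_betw cl {..<n} (classes k)"
    and cl_mono: "\<And>i j. i \<le> j \<Longrightarrow> j < n \<Longrightarrow> ykey (cl i) \<le> ykey (cl j)"
    using sorted_enumeration[of "classes k" ykey] finite_classes unfolding n_def by blast
  define wl where "wl v = lkey (cl (level v))" for v
  define wr where "wr v = rkey (cl (level v))" for v
  have up: "real (level a) < real (level b)" if "a \<in> V" "b \<in> V" "below wl a b \<or> below wr a b" for a b
    using that prec_level[of a n b] by (auto simp: V_def below_def)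
  have "\<exists>C. (\<forall>v. curve (C v) \<and> x_monotone (C v) \<and> C v \<inter> {q. fst q = 0} \<noteq> {}) \<and>
    (\<forall>a\<in>V. \<forall>b\<in>V. C a \<inter> C b = {} \<longleftrightarrow>
      below wl a b \<and> below wr a b \<or> below wl b a \<and> below wr b a)" (is "\<exists>C. ?P C")
    using finite_Zykov below_trans up unfolding V_def
    by (intro two_sided_realization[where p = "\<lambda>v. real (level v)" and len\<^sub>1 = wl and len\<^sub>2 = wr]) blast+
  then obtain C where "?P C" ..
  then have C: "\<And>v. curve (C v)" "\<And>v. x_monotone (C v)" "\<And>v. C v \<inter> {q. fst q = 0} \<noteq> {}"
    and disj: "\<And>a b. a \<in> V \<Longrightarrow> b \<in> V \<Longrightarrow>
      C a \<inter> C b = {} \<longleftrightarrow> below wl a b \<and> below wr a b \<or> below wl b a \<and> below wr b a"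
    by simp_all
  have card_le: "card K \<le> k" if K: "K \<subseteq> C ` V" "disjoint K" for K
  proof -
    \<comment> \<open>One vertex per curve is chosen, as \<open>C\<close> is not known to be
      injective.\<close>
    obtain T where T: "T \<subseteq> V" "K = C ` T" "inj_on C T"
      using K(1) unfolding subset_image_inj by blast
    have adj: "below wl a b \<and> below wr a b \<or> below wl b a \<and> below wr b a"
      if "a \<in> T" "b \<in> T" "a \<noteq> b" for a b
    proof -
      have "C a \<noteq> C b" using T(3) that by (auto simp: inj_on_def)
      then have "C a \<inter> C b = {}" using K(2) T(2) that by (auto simp: pairwise_def disjnt_def)
      then show ?thesis using disj T(1) that by blast
    qed
    have lvl: "level v < n" if "v \<in> T" for v using that T(1) level_less by (auto simp: V_def)
    have prec_lvl: "level a < level b" if "prec a b" "a \<in> T" "b \<in> T" for a b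
      using that T(1) prec_level[of a n b] by (auto simp: V_def)
    define X where "X = (\<lambda>v. cl (level v)) ` T"
    have "inj_on level T"
      using adj prec_lvl by (intro inj_onI) (metis below_def less_irrefl)
    then have "inj_on (cl \<circ> level) T"
      using bij lvl by (intro comp_inj_on) (auto simp: bij_betw_def intro: inj_on_subset)
    then have "card X = card T" unfolding X_def by (simp add: card_image o_def)
    also have "\<dots> = card K" using T by (simp add: card_image)
    finally have "card K = card X" by simp
    also have "card X \<le> k"
    proof (rule card_no_valley_le)
      show "X \<subseteq> classes k" using bij lvl by (auto simp: X_def bij_betw_def)
      fix a b c assume abc: "a \<in> X" "b \<in> X" "c \<in> X" "ykey a < ykey b" "ykey b < ykey c"
      then obtain u v w where uvw: "u \<in> T" "v \<in> T" "w \<in> T"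
        "a = cl (level u)" "b = cl (level v)" "c = cl (level w)" by (auto simp: X_def)
      have prec: "below wl x y \<and> below wr x y"
        if "x \<in> T" "y \<in> T" "ykey (cl (level x)) < ykey (cl (level y))" for x y
      proof -
        have "level x < level y" using cl_mono[of "level y" "level x"] lvl that by (meson not_le)
        then show ?thesis
          using adj[of x y] prec_lvl[of y x] that by (auto simp: below_def)
      qed
      \<comment> \<open>The outer pair is related on both sides and \<open>v\<close> lies between,
        which rules out a valley at \<open>v\<close>.\<close>
      have "prec u v" "prec v w" "below wl u w" "below wr u w"
        using prec[of u v] prec[of v w] prec[of u w] uvw abc by (auto simp: below_def)
      then show "(lkey a \<le> lkey b \<or> lkey c \<le> lkey b) \<and> (rkey a \<le> rkey b \<or> rkey c \<le> rkey b)"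
        unfolding below_def uvw wl_def wr_def by blast
    qed
    finally show ?thesis .
  qed
  have colors: "n \<le> card (f ` C ` V)"
    if f: "\<And>A B. A \<in> C ` V \<Longrightarrow> B \<in> C ` V \<Longrightarrow> A \<inter> B = {} \<Longrightarrow> f A \<noteq> f B" for f :: "_ \<Rightarrow> nat"
  proof -
    have "n \<le> card ((\<lambda>v. f (C v)) ` V)"
      unfolding V_def
    proof (rule card_colors_Zykov)
      fix u v assume "u \<in> Zykov n" "v \<in> Zykov n" "covers u v"
      then show "f (C u) \<noteq> f (C v)"
        using f[of "C u" "C v"] disj[of u v] covers_below V_def by auto
    qed
    then show ?thesis by (simp add: image_image)
  qed
  show thesis
  proof
    show "crossing_family (C ` V)"
      using C by (auto simp: crossing_family_def V_def finite_Zykov)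
  qed (use card_le colors n_def in auto)
qed

section \<open>Raising the clique number to \<open>k\<close>\<close>

lemma crossing_family_subset: "crossing_family \<D> \<Longrightarrow> S \<subseteq> \<D> \<Longrightarrow> crossing_family S"
  unfolding crossing_family_def by (meson finite_subset subset_iff)

text \<open>Each curve meets the line at most once, so finitely many leave a free height; a single
  point is a curve by a constant path.\<close>

lemma crossing_family_insert_point:
  assumes "crossing_family \<C>"
  shows "\<exists>h. crossing_family (insert {(0, h)} \<C>) \<and> (0, h) \<notin> \<Union>\<C>"
proof -
  have "finite {h. (0, h) \<in> C}" if "C \<in> \<C>" for C
  proof -
    have "x_monotone C" using assms that by (auto simp: crossing_family_def)
    moreover have "vertical_line {q. fst q = 0}" by (auto simp: vertical_line_def)
    ultimately have eq: "p = q" if "p \<in> C" "q \<in> C" "fst p = 0" "fst q = 0" for p q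
      using that unfolding x_monotone_def by blast
    show ?thesis
    proof (cases "\<exists>h. (0, h) \<in> C")
      case True
      then obtain h where "(0, h) \<in> C" by blast
      then have "{h. (0, h) \<in> C} \<subseteq> {h}" using eq by auto
      then show ?thesis using finite_subset by blast
    qed simp
  qed
  then have "finite (\<Union>C\<in>\<C>. {h. (0, h) \<in> C})"
    using assms by (auto simp: crossing_family_def)
  then obtain h :: real where h: "h \<notin> (\<Union>C\<in>\<C>. {h. (0, h) \<in> C})"
    using ex_new_if_finite[OF infinite_UNIV_char_0] by blast
  have "{(0, h)} = path_image (linepath (0, h) (0, h))" by simp
  then have "curve {(0, h)}" unfolding curve_def using path_linepath by blast
  then have "crossing_family (insert {(0, h)} \<C>)"
    using assms by (auto simp: crossing_family_def x_monotone_def)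
  then show ?thesis using h by auto
qed

text \<open>The construction only bounds cliques from above. Adding a point disjoint from all curves
  raises the clique number by one, so \<open>k\<close> is reached step by step.\<close>

lemma extend_to_clique:
  assumes "crossing_family \<C>" and le: "\<And>K. K \<subseteq> \<C> \<Longrightarrow> disjoint K \<Longrightarrow> card K \<le> k"
  obtains \<D> K where "crossing_family \<D>" "\<C> \<subseteq> \<D>"
    and "\<And>K. K \<subseteq> \<D> \<Longrightarrow> disjoint K \<Longrightarrow> card K \<le> k"
    and "K \<subseteq> \<D>" "disjoint K" "card K = k"
proof -
  have "\<exists>\<D>. crossing_family \<D> \<and> \<C> \<subseteq> \<D> \<and> (\<forall>K. K \<subseteq> \<D> \<and> disjoint K \<longrightarrow> card K \<le> k) \<and>
      (\<exists>K. K \<subseteq> \<D> \<and> disjoint K \<and> card K = j)" if "j \<le> k" for j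
    using that
  proof (induction j)
    case 0
    have "({} :: (real \<times> real) set set) \<subseteq> \<C> \<and> disjoint ({} :: (real \<times> real) set set) \<and>
        card ({} :: (real \<times> real) set set) = 0" by simp
    then show ?case using assms by blast
  next
    case (Suc j)
    then obtain \<D> K where D: "crossing_family \<D>" "\<C> \<subseteq> \<D>"
      "\<And>K. K \<subseteq> \<D> \<Longrightarrow> disjoint K \<Longrightarrow> card K \<le> k"
      and K: "K \<subseteq> \<D>" "disjoint K" "card K = j" by auto
    show ?case
    proof (cases "\<exists>L\<subseteq>\<D>. disjoint L \<and> card L = Suc j")
      case True
      then show ?thesis using D by blast
    next
      case False
      have D_le: "card L \<le> j" if L: "L \<subseteq> \<D>" "disjoint L" for L
      proof (rule ccontr)
        assume "\<not> card L \<le> j"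
        then have "Suc j \<le> card L" by simp
        then obtain M where M: "M \<subseteq> L" "card M = Suc j"
          by (rule obtain_subset_with_card_n)
        then have "M \<subseteq> \<D>" "disjoint M" using L pairwise_subset by blast+
        then show False using False M(2) by blast
      qed
      obtain h where h: "crossing_family (insert {(0, h)} \<D>)" "(0, h) \<notin> \<Union>\<D>"
        using crossing_family_insert_point[OF D(1)] by blast
      have fin: "finite \<D>" using D(1) by (simp add: crossing_family_def)
      have "card L \<le> k" if L: "L \<subseteq> insert {(0, h)} \<D>" "disjoint L" for L
      proof -
        have "card (L - {{(0, h)}}) \<le> j"
        proof (rule D_le)
          show "L - {{(0, h)}} \<subseteq> \<D>" using L(1) by blast
          show "disjoint (L - {{(0, h)}})" by (rule pairwise_subset[OF L(2)]) blast
        qed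
        moreover have "card L \<le> Suc (card (L - {{(0, h)}}))"
          using card.remove[of L "{(0, h)}"] finite_subset[OF L(1)] fin
          by (cases "{(0, h)} \<in> L") simp_all
        ultimately show ?thesis using Suc.prems by simp
      qed
      moreover have disj: "disjnt {(0, h)} B" "disjnt B {(0, h)}" if "B \<in> K" for B
        using K(1) h(2) that by (auto simp: disjnt_iff)
      then have "disjoint (insert {(0, h)} K)"
        using K(2) by (simp add: pairwise_insert)
      moreover have "{(0, h)} \<notin> K" using disj(1)[of "{(0, h)}"] by (auto simp: disjnt_iff)
      then have "card (insert {(0, h)} K) = Suc j"
        using K(3) finite_subset[OF K(1) fin] by simp
      moreover have "insert {(0, h)} K \<subseteq> insert {(0, h)} \<D>" using K(1) by blast
      ultimately show ?thesis using h(1) D(2) by (meson subset_insertI2)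
    qed
  qed
  from this[of k] show thesis using that by auto
qed

section \<open>Exact clique and chromatic numbers\<close>

lemma disjointness_edge_iff:
  "{A, B} \<in> disjointness_edges S \<longleftrightarrow> A \<in> S \<and> B \<in> S \<and> A \<noteq> B \<and> A \<inter> B = {}"
  unfolding disjointness_edges_def by (auto simp: doubleton_eq_iff)

lemma proper_coloring_disjointness:
  "proper_coloring S (disjointness_edges S) n f \<longleftrightarrow>
    f ` S \<subseteq> {..<n} \<and> (\<forall>A\<in>S. \<forall>B\<in>S. A \<noteq> B \<and> A \<inter> B = {} \<longrightarrow> f A \<noteq> f B)"
  by (auto simp: proper_coloring_def disjointness_edge_iff)

lemma clique_number_eqI:
  assumes "finite S" "\<And>K. K \<subseteq> S \<Longrightarrow> disjoint K \<Longrightarrow> card K \<le> k"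
    and "K \<subseteq> S" "disjoint K" "card K = k"
  shows "clique_number S (disjointness_edges S) = k"
proof -
  have iff: "clique L (disjointness_edges S) \<longleftrightarrow> disjoint L" if "L \<subseteq> S" for L
    using that by (auto simp: clique_def disjointness_edge_iff pairwise_def disjnt_def)
  show ?thesis
    unfolding clique_number_def
  proof (rule Max_eqI)
    have "{card K |K. K \<subseteq> S \<and> clique K (disjointness_edges S)} \<subseteq> card ` Pow S" by blast
    then show "finite {card K |K. K \<subseteq> S \<and> clique K (disjointness_edges S)}"
      using assms(1) finite_subset by blast
    show "n \<le> k" if "n \<in> {card K |K. K \<subseteq> S \<and> clique K (disjointness_edges S)}" for n
      using that iff assms(2) by blast
    show "k \<in> {card K |K. K \<subseteq> S \<and> clique K (disjointness_edges S)}"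
      using assms(3-5) iff by blast
  qed
qed

text \<open>Take a smallest subfamily containing \<open>K\<close> that is not
  \<open>(N - 1)\<close>-colorable. If it is larger than \<open>K\<close>, some curve outside
  \<open>K\<close> can be deleted and then restored with one new color; if it equals
  \<open>K\<close>, its size gives an \<open>N\<close>-coloring.\<close>

lemma subfamily_with_chromatic_number:
  assumes fin: "finite \<D>" and K: "K \<subseteq> \<D>" "card K \<le> N" and N: "0 < N"
    and no_coloring: "\<And>f. \<not> proper_coloring \<D> (disjointness_edges \<D>) (N - 1) f"
  obtains S where "K \<subseteq> S" "S \<subseteq> \<D>" "chromatic_number S (disjointness_edges S) = N"
proof -
  define col where "col S n \<longleftrightarrow> (\<exists>f. proper_coloring S (disjointness_edges S) n f)"
    for S :: "'a set set" and n
  define P where "P T \<longleftrightarrow> K \<subseteq> T \<and> T \<subseteq> \<D> \<and> \<not> col T (N - 1)" for T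
  have "P \<D>" using K(1) no_coloring by (simp add: P_def col_def)
  then obtain S where "P S" and "\<forall>T. P T \<longrightarrow> card S \<le> card T"
    using ex_has_least_nat[of P \<D> card] by blast
  then have S: "K \<subseteq> S" "S \<subseteq> \<D>" "\<not> col S (N - 1)"
    and least: "\<And>T. K \<subseteq> T \<Longrightarrow> T \<subseteq> \<D> \<Longrightarrow> \<not> col T (N - 1) \<Longrightarrow> card S \<le> card T"
    by (auto simp: P_def)
  have finS: "finite S" using S(2) fin finite_subset by blast
  have "col S N"
  proof (cases "S = K")
    case True
    obtain f where f: "bij_betw f K {0..<card K}"
      using True finS ex_bij_betw_finite_nat by blast
    then have "proper_coloring S (disjointness_edges S) N f"
      using True K(2) unfolding proper_coloring_disjointness
      by (force simp: bij_betw_def inj_on_def)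
    then show ?thesis by (auto simp: col_def)
  next
    case False
    then obtain c where c: "c \<in> S" "c \<notin> K" using S(1) by blast
    then have "card (S - {c}) < card S" using card_Diff1_less[OF finS] by blast
    then have "col (S - {c}) (N - 1)" using least[of "S - {c}"] S(1,2) c by fastforce
    then obtain f where "proper_coloring (S - {c}) (disjointness_edges (S - {c})) (N - 1) f"
      unfolding col_def ..
    then have f: "\<forall>A\<in>S - {c}. f A < N - 1"
      "\<forall>A\<in>S - {c}. \<forall>B\<in>S - {c}. A \<noteq> B \<and> A \<inter> B = {} \<longrightarrow> f A \<noteq> f B"
      unfolding proper_coloring_disjointness image_subset_iff lessThan_iff by blast+
    have f_less: "f A < N - 1" if "A \<in> S" "A \<noteq> c" for A
      using f(1) that by simp
    have "proper_coloring S (disjointness_edges S) N (f(c := N - 1))"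
      unfolding proper_coloring_disjointness
    proof (intro conjI ballI impI; (elim conjE)?)
      show "(f(c := N - 1)) ` S \<subseteq> {..<N}"
      proof (rule image_subsetI)
        show "(f(c := N - 1)) A \<in> {..<N}" if "A \<in> S" for A
          using f_less[of A] N that by (cases "A = c") auto
      qed
      fix A B assume "A \<in> S" "B \<in> S" "A \<noteq> B" "A \<inter> B = {}"
      then show "(f(c := N - 1)) A \<noteq> (f(c := N - 1)) B"
        using f(2) f_less[of A] f_less[of B] by (cases "A = c"; cases "B = c") simp_all
    qed
    then show ?thesis by (auto simp: col_def)
  qed
  moreover have "N \<le> n" if "col S n" for n
  proof (rule ccontr)
    assume "\<not> N \<le> n"
    then have "{..<n} \<subseteq> {..<N - 1}" by auto
    then have "col S (N - 1)"
      using that unfolding col_def proper_coloring_disjointness by (meson subset_trans)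
    then show False using S(3) by simp
  qed
  ultimately have "chromatic_number S (disjointness_edges S) = N"
    unfolding chromatic_number_def col_def by (intro Least_equality) auto
  then show thesis using that S(1,2) by blast
qed

theorem theorem4:
  fixes k :: nat
  assumes "k \<ge> 2"
  shows "\<exists>(\<C> :: (real \<times> real) set set) l.
    finite \<C> \<and>
    (\<forall>C\<in>\<C>. curve C \<and> x_monotone C) \<and>
    vertical_line l \<and> (\<forall>C\<in>\<C>. C \<inter> l \<noteq> {}) \<and>
    clique_number \<C> (disjointness_edges \<C>) = k \<and>
    real (chromatic_number \<C> (disjointness_edges \<C>)) =
      (real k + 1) / 2 * real ((k + 2) choose 3)"
proof -
  define N where "N = card (classes k)"
  have N: "k \<le> N" "0 < N" using le_card_classes[of k] assms by (simp_all add: N_def)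
  obtain \<C> where C: "crossing_family \<C>" "\<And>K. K \<subseteq> \<C> \<Longrightarrow> disjoint K \<Longrightarrow> card K \<le> k"
    and colors: "\<And>f :: _ \<Rightarrow> nat. (\<And>A B. A \<in> \<C> \<Longrightarrow> B \<in> \<C> \<Longrightarrow> A \<inter> B = {} \<Longrightarrow> f A \<noteq> f B) \<Longrightarrow>
      N \<le> card (f ` \<C>)"
    unfolding N_def using extremal_family[of k] by metis
  obtain \<D> K where D: "crossing_family \<D>" "\<C> \<subseteq> \<D>"
    and le: "\<And>K. K \<subseteq> \<D> \<Longrightarrow> disjoint K \<Longrightarrow> card K \<le> k"
    and K: "K \<subseteq> \<D>" "disjoint K" "card K = k"
    using extend_to_clique[OF C] by metis
  have "\<not> proper_coloring \<D> (disjointness_edges \<D>) (N - 1) f" for f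
  proof
    assume f: "proper_coloring \<D> (disjointness_edges \<D>) (N - 1) f"
    have "N \<le> card (f ` \<C>)"
    proof (rule colors)
      fix A B assume AB: "A \<in> \<C>" "B \<in> \<C>" "A \<inter> B = {}"
      \<comment> \<open>Members of the family meet the line, hence are nonempty and not disjoint
        from themselves.\<close>
      then have "A \<noteq> B" using C(1) by (auto simp: crossing_family_def)
      moreover have "A \<in> \<D>" "B \<in> \<D>" using AB D(2) by auto
      ultimately show "f A \<noteq> f B" using AB(3) f unfolding proper_coloring_disjointness by blast
    qed
    moreover have "f ` \<C> \<subseteq> {..<N - 1}"
      using f D(2) unfolding proper_coloring_disjointness by blast
    then have "card (f ` \<C>) \<le> N - 1" using card_mono[of "{..<N - 1}" "f ` \<C>"] by simp
    ultimately show False using N(2) by linarith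
  qed
  \<comment> \<open>Keeping \<open>K\<close> inside \<open>S\<close> prevents the clique number from
    dropping below \<open>k\<close>.\<close>
  then obtain S where S: "K \<subseteq> S" "S \<subseteq> \<D>" "chromatic_number S (disjointness_edges S) = N"
    using subfamily_with_chromatic_number[of \<D> K N] D(1) K N crossing_family_def by metis
  have fam: "crossing_family S" using crossing_family_subset D(1) S(2) by blast
  then have "finite S" by (simp add: crossing_family_def)
  moreover have "card L \<le> k" if "L \<subseteq> S" "disjoint L" for L
    using le that S(2) by (meson subset_trans)
  ultimately have "clique_number S (disjointness_edges S) = k"
    by (rule clique_number_eqI[OF _ _ S(1) K(2,3)])
  moreover have "vertical_line {q. fst q = 0}" by (auto simp: vertical_line_def)
  moreover have "real N = (real k + 1) / 2 * real ((k + 2) choose 3)"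
    unfolding N_def by (rule card_classes)
  ultimately show ?thesis
    using S(3) fam unfolding crossing_family_def
    by (intro exI[of _ S] exI[of _ "{q. fst q = 0}"]) simp
qed

end
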